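(* Let $G$ be a connected simple graph on $n$ vertices. Then $\mathrm{gpn}(G)\geq\binom{n+1}{2}$, with equality if and only if $G$ is a geodetic graph.
   Context: All graphs are finite, simple and connected. A geodesic between vertices $u$ and $v$ of a graph $G$ is a shortest path connecting $u$ and $v$. For distinct $u,v\in V(G)$, $\mathrm{gpn}_G(u,v)$ denotes the number of shortest $u$–$v$ paths in $G$. The geodesic subpath number of a graph $G$ on $n$ vertices is $\mathrm{gpn}(G)=\sum_{\{u,v\}\subseteq V(G),\,u\neq v}\mathrm{gpn}_G(u,v)+n$ (the sum is over unordered pairs of distinct vertices; the term $n$ counts the geodesics of length zero). A geodetic graph is a graph in which every pair of vertices is connected by exactly one geodesic. *)

theory Defs
  imports
    "Graph_Theory.Digraph_Component_Vwalk"
    "HOL.Binomial"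
begin

text \<open>
  Finite simple graphs are the finite loop-free symmetric digraphs without parallel arcs of
  \<^locale>\<open>graph\<close>. In such a graph a path is determined by its vertex sequence, so paths are
  represented by \<^const>\<open>vpath\<close>; the empty list is not a path, and \<open>[u]\<close> is the path of
  length zero at \<open>u\<close>. A path has a direction: \<open>rev p\<close> is a path from \<open>v\<close> to \<open>u\<close> and is
  counted for \<open>(v, u)\<close>, not for \<open>(u, v)\<close>.
\<close>

definition paths_between :: "('a,'b) pre_digraph \<Rightarrow> 'a \<Rightarrow> 'a \<Rightarrow> 'a vwalk set" where
  "paths_between G u v = {p. vpath p G \<and> hd p = u \<and> last p = v}"

definition geodesic :: "('a,'b) pre_digraph \<Rightarrow> 'a \<Rightarrow> 'a vwalk \<Rightarrow> 'a \<Rightarrow> bool" where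
  "geodesic G u p v \<longleftrightarrow>
     p \<in> paths_between G u v \<and>
     (\<forall>q \<in> paths_between G u v. vwalk_length p \<le> vwalk_length q)"

definition gpn_between :: "('a,'b) pre_digraph \<Rightarrow> 'a \<Rightarrow> 'a \<Rightarrow> nat" where
  "gpn_between G u v = card {p. geodesic G u p v}"

text \<open>
  The number of geodesics as a function of an unordered pair. Symmetry of
  \<^const>\<open>gpn_between\<close> makes the description unique; see \<open>gpn_pair_doubleton\<close> below.
\<close>

definition gpn_pair :: "('a,'b) pre_digraph \<Rightarrow> 'a set \<Rightarrow> nat" where
  "gpn_pair G e = (THE k. \<forall>u v. e = {u, v} \<longrightarrow> k = gpn_between G u v)"

definition gpn :: "('a,'b) pre_digraph \<Rightarrow> nat" where
  "gpn G = (\<Sum>e \<in> {{u, v} | u v. u \<in> verts G \<and> v \<in> verts G \<and> u \<noteq> v}. gpn_pair G e)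
           + card (verts G)"

definition geodetic :: "('a,'b) pre_digraph \<Rightarrow> bool" where
  "geodetic G \<longleftrightarrow> (\<forall>u \<in> verts G. \<forall>v \<in> verts G. \<exists>!p. geodesic G u p v)"

lemma paths_between_rev:
  assumes "symmetric G" and "p \<in> paths_between G u v"
  shows "rev p \<in> paths_between G v u"
proof -
  have p: "vwalk p G" "distinct p" "hd p = u" "last p = v"
    using assms(2) unfolding paths_between_def vpath_def by simp_all
  then have "p \<noteq> []"
    unfolding vwalk_def by simp
  then have "hd (rev p) = v" "last (rev p) = u"
    using p(3,4) by (simp_all only: hd_rev last_rev)
  moreover have "vwalk (rev p) G"
    using assms(1) p(1) by (rule vwalk_rev_ex)
  ultimately show ?thesis
    using p(2) unfolding paths_between_def vpath_def by simp
qed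

lemma geodesic_rev:
  assumes "symmetric G" and "geodesic G u p v"
  shows "geodesic G v (rev p) u"
  unfolding geodesic_def
proof (intro conjI ballI)
  show "rev p \<in> paths_between G v u"
    using assms(2) paths_between_rev[OF assms(1)] by (simp add: geodesic_def)
next
  fix q assume "q \<in> paths_between G v u"
  then have "rev q \<in> paths_between G u v"
    by (rule paths_between_rev[OF assms(1)])
  then have "vwalk_length p \<le> vwalk_length (rev q)"
    using assms(2)[unfolded geodesic_def] by (elim conjE) (rule bspec)
  then show "vwalk_length (rev p) \<le> vwalk_length q" by simp
qed

lemma gpn_between_commute:
  assumes "symmetric G"
  shows "gpn_between G u v = gpn_between G v u"
proof -
  have "bij_betw rev {p. geodesic G u p v} {p. geodesic G v p u}"
  proof (rule bij_betwI[where g = rev])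
    show "rev \<in> {p. geodesic G u p v} \<rightarrow> {p. geodesic G v p u}"
      by (intro funcsetI CollectI geodesic_rev[OF assms]) (erule CollectD)
    show "rev \<in> {p. geodesic G v p u} \<rightarrow> {p. geodesic G u p v}"
      by (intro funcsetI CollectI geodesic_rev[OF assms]) (erule CollectD)
  qed simp_all
  then show ?thesis
    unfolding gpn_between_def by (rule bij_betw_same_card)
qed

lemma gpn_pair_doubleton:
  assumes "symmetric G"
  shows "gpn_pair G {u, v} = gpn_between G u v"
  unfolding gpn_pair_def
proof (rule the_equality)
  show "\<forall>x y. {u, v} = {x, y} \<longrightarrow> gpn_between G u v = gpn_between G x y"
    unfolding doubleton_eq_iff using gpn_between_commute[OF assms, of u v] by blast
next
  fix k assume "\<forall>x y. {u, v} = {x, y} \<longrightarrow> k = gpn_between G x y"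
  then show "k = gpn_between G u v" by blast
qed

end

theory Submission
  imports Defs
begin

text \<open>In a connected graph every pair of distinct vertices is joined by a path, hence by a
  shortest one (\<open>geodesic_exists\<close>), so each of the n choose 2 unordered pairs
  contributes at least 1 to \<open>gpn G\<close> (\<open>gpn_between_pos\<close>). Adding the n
  geodesics of length zero gives the bound. A finite sum of terms that are all at least 1 equals the
  number of its terms only if every term is 1. That is uniqueness of geodesics between distinct
  vertices, which is the same as \<open>geodetic G\<close>, since the pairs (u, u) always have just
  one geodesic (\<open>geodetic_iff_gpn_between_eq_1\<close>).\<close>

text \<open>Since \<open>card\<close> is 0 on infinite sets, finiteness is what lets the existence
  of a geodesic yield a positive count.\<close>

lemma (in fin_digraph) finite_geodesics: "finite {p. geodesic G u p v}"
  by (rule finite_subset[OF _ vpaths_finite]) (auto simp: geodesic_def paths_between_def)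

text \<open>Reachability provides some path, and lengths are natural numbers, so a shortest path
  exists.\<close>

lemma (in wf_digraph) geodesic_exists:
  assumes "u \<rightarrow>\<^sup>* v"
  shows "\<exists>p. geodesic G u p v"
proof -
  obtain q where "q \<in> paths_between G u v"
    using assms by (auto simp: reachable_vpath_conv paths_between_def)
  then have "is_arg_min vwalk_length (\<lambda>p. p \<in> paths_between G u v)
      (arg_min vwalk_length (\<lambda>p. p \<in> paths_between G u v))"
    by (intro is_arg_min_arg_min_nat)
  then show ?thesis
    unfolding geodesic_def is_arg_min_linorder by blast
qed

lemma (in fin_digraph) gpn_between_pos:
  assumes "u \<rightarrow>\<^sup>* v"
  shows "1 \<le> gpn_between G u v"
  using geodesic_exists[OF assms] finite_geodesics[of u v]
  by (auto simp: gpn_between_def Suc_le_eq card_gt_0_iff)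

lemma gpn_between_eq_1_iff: "gpn_between G u v = 1 \<longleftrightarrow> (\<exists>!p. geodesic G u p v)"
  unfolding gpn_between_def One_nat_def card_1_singleton_iff Ex1_def set_eq_iff
    mem_Collect_eq singleton_iff
  by (rule iff_exI) blast

text \<open>A list without repetitions whose first and last entries coincide has only one
  entry.\<close>

lemma geodesic_refl_iff:
  assumes "u \<in> verts G"
  shows "geodesic G u p u \<longleftrightarrow> p = [u]"
proof -
  have "paths_between G u u \<subseteq> {[u]}"
  proof
    fix q assume "q \<in> paths_between G u u"
    then show "q \<in> {[u]}"
      by (cases q) (auto simp: paths_between_def vpath_def vwalk_def split: if_splits)
  qed
  moreover have "[u] \<in> paths_between G u u"
    using assms by (simp add: paths_between_def vpath_self)
  ultimately have "paths_between G u u = {[u]}"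
    by blast
  then show ?thesis
    by (simp add: geodesic_def cong: conj_cong)
qed

lemma geodetic_iff_gpn_between_eq_1:
  "geodetic G \<longleftrightarrow> (\<forall>u\<in>verts G. \<forall>v\<in>verts G. u \<noteq> v \<longrightarrow> gpn_between G u v = 1)"
proof -
  have "\<exists>!p. geodesic G u p u" if "u \<in> verts G" for u
    unfolding geodesic_refl_iff[OF that] by simp
  then show ?thesis
    unfolding geodetic_def gpn_between_eq_1_iff by (intro ball_cong refl) blast
qed

lemma doubletons_eq_two_subsets:
  "{{u, v} | u v. u \<in> V \<and> v \<in> V \<and> u \<noteq> v} = {e. e \<subseteq> V \<and> card e = 2}"
  by (auto simp: card_2_iff)

theorem mainTheorem1:
  fixes G :: "('a,'b) pre_digraph" and n :: nat
  assumes "Digraph.graph G"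
    and "Digraph_Component.connected G"
    and "card (verts G) = n"
  shows "gpn G \<ge> (n + 1) choose 2 \<and> (gpn G = (n + 1) choose 2 \<longleftrightarrow> geodetic G)"
proof -
  interpret graph G by fact
  define E where "E = {{u, v} | u v. u \<in> verts G \<and> v \<in> verts G \<and> u \<noteq> v}"
  have E: "E = {e. e \<subseteq> verts G \<and> card e = 2}"
    unfolding E_def by (rule doubletons_eq_two_subsets)
  have finE: "finite E"
    unfolding E by simp
  have "card E = n choose 2"
    unfolding E using n_subsets[OF finite_verts] assms(3) by simp
  \<comment> \<open>Pascal's rule, with n choose 2 written as a sum of ones over the pairs so that
    it can be compared with \<open>gpn G\<close> term by term.\<close>
  then have choose: "(n + 1) choose 2 = (\<Sum>e\<in>E. 1) + n"
    by (simp add: numeral_2_eq_2)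
  have gpn: "gpn G = (\<Sum>e\<in>E. gpn_pair G e) + n"
    unfolding gpn_def E_def assms(3) ..
  have pair: "gpn_pair G {u, v} = gpn_between G u v" for u v
    using sym_arcs by (rule gpn_pair_doubleton)
  \<comment> \<open>\<open>connected\<close> speaks of the symmetric closure; as the arcs of
    \<open>G\<close> are already symmetric, it yields directed reachability in \<open>G\<close>
    itself.\<close>
  have reach: "u \<rightarrow>\<^sup>*\<^bsub>G\<^esub> v" if "u \<in> verts G" "v \<in> verts G" for u v
    using symmetric_connected_imp_strongly_connected[OF sym_arcs assms(2)] that
    by (simp add: strongly_connected_def)
  have ge: "1 \<le> gpn_pair G e" if "e \<in> E" for e
    using that gpn_between_pos[OF reach] by (auto simp: E_def pair)
  have "geodetic G \<longleftrightarrow> (\<forall>e\<in>E. gpn_pair G e = 1)"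
    unfolding geodetic_iff_gpn_between_eq_1 E_def pair[symmetric] by blast
  moreover have "(\<Sum>e\<in>E. gpn_pair G e) = (\<Sum>e\<in>E. 1) \<longleftrightarrow> (\<forall>e\<in>E. gpn_pair G e = 1)"
  proof
    assume "(\<Sum>e\<in>E. gpn_pair G e) = (\<Sum>e\<in>E. 1)"
    \<comment> \<open>Termwise inequality together with equality of the finite sums forces equality
      in every term.\<close>
    from sum_mono_inv[OF this[symmetric] ge _ finE]
    show "\<forall>e\<in>E. gpn_pair G e = 1" by simp
  qed simp
  moreover have "(\<Sum>e\<in>E. 1) \<le> (\<Sum>e\<in>E. gpn_pair G e)"
    using ge by (rule sum_mono)
  ultimately show ?thesis
    unfolding choose gpn by simp
qed

end
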